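(* Let $q=p^n$ be a prime power ($p$ prime, $n\ge 1$), let $\mathbb{F}_q$ be the finite field with $q$ elements, let $\alpha,\beta$ be primitive elements of $\mathbb{F}_q^*$, and let $a\in\mathbb{F}_q^*$. Then $$\mathcal{G}(\alpha,\beta,a):=\{(i,\log_\beta(a-\alpha^i)):i=1,\ldots,q-1,\ \alpha^i\neq a\}$$ is a Sidon set on $(\mathbb{Z}_{q-1}\times\mathbb{Z}_{q-1},+)$.
   Context: A primitive element of $\mathbb{F}_q^*$ is a generator of the multiplicative group $\mathbb{F}_q^*$. For a primitive element $\theta$ and $x\in\mathbb{F}_q^*$, $\log_\theta(x)$ denotes the unique integer $k\in[1,q-1]$ with $\theta^k=x$ in $\mathbb{F}_q$. Pairs of integers are regarded as elements of $\mathbb{Z}_{q-1}\times\mathbb{Z}_{q-1}$, where $\mathbb{Z}_{q-1}$ is the additive group of integers modulo $q-1$. A subset $\mathcal{A}$ of an abelian group $(G,+)$ is a Sidon set on $G$ if every $x\in G$ can be written in at most one way as a sum $x=a_1+a_2$ of two (not necessarily distinct) elements $a_1,a_2\in\mathcal{A}$, up to rearrangement of the summands. *)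

theory Defs
  imports "HOL-Algebra.Multiplicative_Group" "HOL-Algebra.Elementary_Groups" "HOL-Computational_Algebra.Primes"
begin

definition primitive_element :: "('a, 'b) ring_scheme \<Rightarrow> 'a \<Rightarrow> bool" where
  "primitive_element F \<theta> \<longleftrightarrow>
     \<theta> \<in> carrier (mult_of F) \<and> generate (mult_of F) {\<theta>} = carrier (mult_of F)"

(* Only meaningful for primitive \<theta> and nonzero x; note that the range is
   [1, q - 1] rather than [0, q - 2]. *)
definition discrete_log :: "('a, 'b) ring_scheme \<Rightarrow> 'a \<Rightarrow> 'a \<Rightarrow> nat" where
  "discrete_log F \<theta> x = (THE k. k \<in> {1..order F - 1} \<and> \<theta> [^]\<^bsub>F\<^esub> k = x)"

definition sidon_set :: "('a, 'b) monoid_scheme \<Rightarrow> 'a set \<Rightarrow> bool" where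
  "sidon_set G A \<longleftrightarrow> comm_group G \<and> A \<subseteq> carrier G \<and>
     (\<forall>x\<in>carrier G. \<forall>a1\<in>A. \<forall>a2\<in>A. \<forall>b1\<in>A. \<forall>b2\<in>A.
        x = a1 \<otimes>\<^bsub>G\<^esub> a2 \<and> x = b1 \<otimes>\<^bsub>G\<^esub> b2 \<longrightarrow>
          (a1 = b1 \<and> a2 = b2) \<or> (a1 = b2 \<and> a2 = b1))"

(* integer_mod_group m is carried by the representatives {0..<m}, so the
   exponent q - 1 has to be reduced to 0. *)
definition residue_pair :: "nat \<Rightarrow> nat \<times> nat \<Rightarrow> int \<times> int" where
  "residue_pair m = (\<lambda>(i, j). (int i mod int m, int j mod int m))"

definition log_graph :: "('a, 'b) ring_scheme \<Rightarrow> 'a \<Rightarrow> 'a \<Rightarrow> 'a \<Rightarrow> (int \<times> int) set" where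
  "log_graph F \<alpha> \<beta> a =
     {residue_pair (order F - 1) (i, discrete_log F \<beta> (a \<ominus>\<^bsub>F\<^esub> \<alpha> [^]\<^bsub>F\<^esub> i)) | i.
        i \<in> {1..order F - 1} \<and> \<alpha> [^]\<^bsub>F\<^esub> i \<noteq> a}"

end

(* If two elements of the graph, with field coordinates (u1, a - u1) and (u2, a - u2), have the
   same sum as (w1, a - w1) and (w2, a - w2), then the products agree in both coordinates:
   u1 u2 = w1 w2 and (a - u1)(a - u2) = (a - w1)(a - w2).  As a is nonzero, the second equation
   gives u1 + u2 = w1 + w2, so both pairs are the roots of one quadratic polynomial. *)

theory Submission
  imports Defs
begin

lemma DirProd_comm_group:
  assumes "comm_group G" and "comm_group H"
  shows "comm_group (G \<times>\<times> H)"
proof -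
  interpret G: comm_group G by fact
  interpret H: comm_group H by fact
  show ?thesis
    by (rule group.group_comm_groupI)
      (auto simp: DirProd_group G.is_group H.is_group G.m_comm H.m_comm)
qed

text \<open>Elements of infinite order are covered too: there \<open>ord x\<close> is 0, and
  \<open>k mod 0 = k\<close>.\<close>

lemma (in group) pow_mod_ord:
  fixes k :: nat
  assumes "x \<in> carrier G"
  shows "x [^] (k mod ord x) = x [^] k"
proof -
  have "x [^] k = x [^] (ord x * (k div ord x) + k mod ord x)"
    by simp
  also have "\<dots> = x [^] (ord x * (k div ord x)) \<otimes> x [^] (k mod ord x)"
    using assms by (simp only: nat_pow_mult)
  also have "\<dots> = x [^] (k mod ord x)"
    using assms by (simp add: nat_pow_pow [symmetric])
  finally show ?thesis ..
qed

context field
begin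

lemma primitive_element_closed:
  "primitive_element R \<theta> \<Longrightarrow> \<theta> \<in> carrier R"
  by (simp add: primitive_element_def)

lemma ord_primitive_element:
  assumes "finite (carrier R)" and "primitive_element R \<theta>"
  shows "group.ord (mult_of R) \<theta> = order R - 1"
  using assms group.generate_pow_card [OF field_mult_group, of \<theta>]
  by (simp add: primitive_element_def order_mult_of [symmetric] order_def)

lemma primitive_pow_mod:
  assumes "finite (carrier R)" and "primitive_element R \<theta>"
  shows "\<theta> [^] (k mod (order R - 1)) = \<theta> [^] k"
  using group.pow_mod_ord [OF field_mult_group, of \<theta> k] assms ord_primitive_element
  by (simp add: primitive_element_def nat_pow_mult_of)

text \<open>The exponents here are the representatives that \<open>integer_mod_group\<close> uses,
  not the range of \<open>discrete_log\<close>; this serves to read coordinates back from field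
  elements.\<close>

lemma primitive_pow_inj_lessThan:
  assumes "finite (carrier R)" and "primitive_element R \<theta>"
  shows "inj_on (\<lambda>k::nat. \<theta> [^] k) {..<order R - 1}"
proof -
  have "inj_on (\<lambda>k::nat. \<theta> [^] k) {0..order R - 1 - 1}"
    using group.ord_inj [OF field_mult_group, of \<theta>] assms ord_primitive_element
    by (simp add: primitive_element_def nat_pow_mult_of)
  then show ?thesis
    by (rule inj_on_subset) auto
qed

text \<open>Counting makes the \<open>THE\<close> well defined: the powers with exponents in
  \<open>?I\<close> are distinct and nonzero, and there are as many of them as nonzero field
  elements, so each such element is hit exactly once.\<close>

lemma pow_discrete_log:
  assumes fin: "finite (carrier R)" and prim: "primitive_element R \<theta>"
    and x: "x \<in> carrier R - {\<zero>}"
  shows "\<theta> [^] discrete_log R \<theta> x = x"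
proof -
  let ?I = "{1..order R - 1}" and ?pow = "\<lambda>k::nat. \<theta> [^] k"
  have inj: "inj_on ?pow ?I"
    using group.ord_inj' [OF field_mult_group, of \<theta>] prim ord_primitive_element [OF fin prim]
    by (simp add: primitive_element_def nat_pow_mult_of)
  have "?pow k \<in> carrier R - {\<zero>}" for k
    using monoid.nat_pow_closed [of "mult_of R" \<theta> k] field_mult_group prim
    by (simp add: primitive_element_def nat_pow_mult_of group.is_monoid)
  moreover have "card (?pow ` ?I) = card (carrier R - {\<zero>})"
    using inj fin by (simp add: card_image order_def)
  ultimately have "?pow ` ?I = carrier R - {\<zero>}"
    using fin by (intro card_subset_eq) auto
  then have "\<exists>k. k \<in> ?I \<and> ?pow k = x"
    using x by (metis imageE)
  then have "\<exists>!k. k \<in> ?I \<and> ?pow k = x"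
    using inj by (metis inj_onD)
  from theI' [OF this] show ?thesis
    unfolding discrete_log_def by blast
qed

text \<open>Trades the logarithm for an additive equation in the field, the only fact about the
  graph that the Sidon argument uses.\<close>

lemma log_graphE:
  assumes fin: "finite (carrier R)"
    and prim: "primitive_element R \<alpha>" "primitive_element R \<beta>"
    and a: "a \<in> carrier R" and x: "x \<in> log_graph R \<alpha> \<beta> a"
  obtains s t where "x = (int s, int t)" "s < order R - 1" "t < order R - 1"
    "\<alpha> [^] s \<oplus> \<beta> [^] t = a"
proof -
  let ?m = "order R - 1"
  obtain i where i: "i \<in> {1..?m}" "\<alpha> [^] i \<noteq> a"
    "x = residue_pair ?m (i, discrete_log R \<beta> (a \<ominus> \<alpha> [^] i))"
    using x unfolding log_graph_def by blast
  define j where "j = discrete_log R \<beta> (a \<ominus> \<alpha> [^] i)"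
  have \<alpha>: "\<alpha> [^] i \<in> carrier R"
    using prim primitive_element_closed by simp
  \<comment> \<open>The condition \<open>\<alpha> [^] i \<noteq> a\<close> makes the argument of the
    logarithm nonzero.\<close>
  have "\<beta> [^] j = a \<ominus> \<alpha> [^] i"
    unfolding j_def using \<alpha> a i by (intro pow_discrete_log fin prim) auto
  then have "\<alpha> [^] (i mod ?m) \<oplus> \<beta> [^] (j mod ?m) = \<alpha> [^] i \<oplus> (a \<ominus> \<alpha> [^] i)"
    using fin prim by (simp only: primitive_pow_mod)
  also have "\<dots> = a"
    using \<alpha> a by algebra
  finally show thesis
    \<comment> \<open>The range of \<open>i\<close> gives \<open>?m > 0\<close>, so both remainders
      lie below \<open>?m\<close>; an exponent equal to \<open>?m\<close> becomes 0.\<close>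
    using i by (intro that [of "i mod ?m" "j mod ?m"])
      (auto simp: residue_pair_def j_def zmod_int)
qed

text \<open>By Vieta, (X - w1)(X - w2) and (X - u1)(X - u2) are the same polynomial, so it vanishes
  at u1. A field has no zero divisors, so u1 is w1 or w2, and the sum fixes the other root.\<close>

lemma eq_pairs_if_sum_prod_eq:
  assumes "u1 \<in> carrier R" "u2 \<in> carrier R" "w1 \<in> carrier R" "w2 \<in> carrier R"
    and sum: "u1 \<oplus> u2 = w1 \<oplus> w2" and prod: "u1 \<otimes> u2 = w1 \<otimes> w2"
  shows "u1 = w1 \<and> u2 = w2 \<or> u1 = w2 \<and> u2 = w1"
proof -
  have "(u1 \<ominus> w1) \<otimes> (u1 \<ominus> w2) = u1 \<otimes> u1 \<ominus> u1 \<otimes> (w1 \<oplus> w2) \<oplus> w1 \<otimes> w2"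
    using assms(1-4) by algebra
  also have "\<dots> = u1 \<otimes> u1 \<ominus> u1 \<otimes> (u1 \<oplus> u2) \<oplus> u1 \<otimes> u2"
    by (simp only: sum prod)
  also have "\<dots> = \<zero>"
    using assms(1-4) by algebra
  finally have "u1 = w1 \<or> u1 = w2"
    using assms(1-4) by (auto dest: integral)
  then show ?thesis
    using assms by (metis a_comm add.right_cancel)
qed

lemma eq_pairs_if_prods_eq:
  assumes carr: "u1 \<in> carrier R" "u2 \<in> carrier R" "w1 \<in> carrier R" "w2 \<in> carrier R"
    "v1 \<in> carrier R" "v2 \<in> carrier R" "z1 \<in> carrier R" "z2 \<in> carrier R"
    and a: "a \<in> carrier R - {\<zero>}"
    and eqs: "u1 \<oplus> v1 = a" "u2 \<oplus> v2 = a" "w1 \<oplus> z1 = a" "w2 \<oplus> z2 = a"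
    and u: "u1 \<otimes> u2 = w1 \<otimes> w2" and v: "v1 \<otimes> v2 = z1 \<otimes> z2"
  shows "u1 = w1 \<and> v1 = z1 \<and> u2 = w2 \<and> v2 = z2 \<or> u1 = w2 \<and> v1 = z2 \<and> u2 = w1 \<and> v2 = z1"
proof -
  \<comment> \<open>This is the expansion of (a - x1)(a - x2) = y1 y2, solved for the sum. The right
    side depends on the pairs only through their two products.\<close>
  have sum: "a \<otimes> (x1 \<oplus> x2) = a \<otimes> a \<oplus> x1 \<otimes> x2 \<ominus> y1 \<otimes> y2"
    if "x1 \<in> carrier R" "x2 \<in> carrier R" "y1 \<in> carrier R" "y2 \<in> carrier R"
      "x1 \<oplus> y1 = a" "x2 \<oplus> y2 = a" for x1 x2 y1 y2
  proof -
    \<comment> \<open>To be an identity in free variables, each \<open>a\<close> is written as one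
      of the two sums equal to it; the last summand corrects for the different choices and vanishes
      once both sums are \<open>a\<close>.\<close>
    have "(x1 \<oplus> y1) \<otimes> (x1 \<oplus> x2) = (x1 \<oplus> y1) \<otimes> (x2 \<oplus> y2) \<oplus> x1 \<otimes> x2 \<ominus> y1 \<otimes> y2
        \<oplus> (x1 \<otimes> ((x1 \<oplus> y1) \<ominus> (x2 \<oplus> y2)))"
      using that(1-4) by algebra
    then show ?thesis
      using that(1-4) a unfolding that(5,6) by (simp add: a_minus_def r_neg)
  qed
  have "a \<otimes> (u1 \<oplus> u2) = a \<otimes> (w1 \<oplus> w2)"
    using carr eqs u v by (simp add: sum)
  then have "u1 \<oplus> u2 = w1 \<oplus> w2"
    using a carr by (simp add: m_lcancel)
  then have "u1 = w1 \<and> u2 = w2 \<or> u1 = w2 \<and> u2 = w1"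
    using carr u by (intro eq_pairs_if_sum_prod_eq)
  then show ?thesis
    using carr eqs by (metis a_comm add.right_cancel)
qed

text \<open>Turns the group law in one coordinate into multiplication in the field.\<close>

lemma primitive_pow_mult_eq:
  assumes "finite (carrier R)" "primitive_element R \<theta>"
    and "(int i1 + int i2) mod int (order R - 1) = (int j1 + int j2) mod int (order R - 1)"
  shows "\<theta> [^] i1 \<otimes> \<theta> [^] i2 = \<theta> [^] j1 \<otimes> \<theta> [^] j2"
proof -
  have "(i1 + i2) mod (order R - 1) = (j1 + j2) mod (order R - 1)"
    using assms(3) by (metis of_nat_add of_nat_eq_iff zmod_int)
  then have "\<theta> [^] (i1 + i2) = \<theta> [^] (j1 + j2)"
    using primitive_pow_mod [OF assms(1,2)] by metis
  then show ?thesis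
    using primitive_element_closed [OF assms(2)] by (simp add: nat_pow_mult)
qed

end

theorem proposition1:
  fixes F :: "('a, 'b) ring_scheme" and p n q :: nat and \<alpha> \<beta> a :: 'a
  assumes "prime p" and "n \<ge> 1" and "q = p ^ n"
    and "field F" and "order F = q"
    and "primitive_element F \<alpha>" and "primitive_element F \<beta>"
    and "a \<in> carrier F - {\<zero>\<^bsub>F\<^esub>}"
  shows "sidon_set (integer_mod_group (q - 1) \<times>\<times> integer_mod_group (q - 1)) (log_graph F \<alpha> \<beta> a)"
proof -
  interpret field F by fact
  have "q > 0"
    using assms(1,3) by (simp add: prime_gt_0_nat)
  \<comment> \<open>An infinite set has \<open>card\<close> 0, so positive order forces
    finiteness.\<close>
  then have fin: "finite (carrier F)"
    using assms(5) by (intro card_ge_0_finite) (simp add: order_def)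
  note prim = assms(6,7) and q = \<open>order F = q\<close>
  let ?Z = "integer_mod_group (q - 1)"
  have a: "a \<in> carrier F" using assms(8) by simp
  note graphE = log_graphE [OF fin prim a, unfolded q]
  have sidon: "x1 = y1 \<and> x2 = y2 \<or> x1 = y2 \<and> x2 = y1"
    if x1: "x1 \<in> log_graph F \<alpha> \<beta> a" and x2: "x2 \<in> log_graph F \<alpha> \<beta> a"
      and y1: "y1 \<in> log_graph F \<alpha> \<beta> a" and y2: "y2 \<in> log_graph F \<alpha> \<beta> a"
      and eq: "x1 \<otimes>\<^bsub>?Z \<times>\<times> ?Z\<^esub> x2 = y1 \<otimes>\<^bsub>?Z \<times>\<times> ?Z\<^esub> y2" for x1 x2 y1 y2
  proof -
    obtain s1 t1 where 1: "x1 = (int s1, int t1)" "s1 < q - 1" "t1 < q - 1"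
      "\<alpha> [^]\<^bsub>F\<^esub> s1 \<oplus>\<^bsub>F\<^esub> \<beta> [^]\<^bsub>F\<^esub> t1 = a" using graphE [OF x1] .
    obtain s2 t2 where 2: "x2 = (int s2, int t2)" "s2 < q - 1" "t2 < q - 1"
      "\<alpha> [^]\<^bsub>F\<^esub> s2 \<oplus>\<^bsub>F\<^esub> \<beta> [^]\<^bsub>F\<^esub> t2 = a" using graphE [OF x2] .
    obtain s3 t3 where 3: "y1 = (int s3, int t3)" "s3 < q - 1" "t3 < q - 1"
      "\<alpha> [^]\<^bsub>F\<^esub> s3 \<oplus>\<^bsub>F\<^esub> \<beta> [^]\<^bsub>F\<^esub> t3 = a" using graphE [OF y1] .
    obtain s4 t4 where 4: "y2 = (int s4, int t4)" "s4 < q - 1" "t4 < q - 1"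
      "\<alpha> [^]\<^bsub>F\<^esub> s4 \<oplus>\<^bsub>F\<^esub> \<beta> [^]\<^bsub>F\<^esub> t4 = a" using graphE [OF y2] .
    have \<alpha>: "\<alpha> [^]\<^bsub>F\<^esub> s1 \<otimes>\<^bsub>F\<^esub> \<alpha> [^]\<^bsub>F\<^esub> s2 = \<alpha> [^]\<^bsub>F\<^esub> s3 \<otimes>\<^bsub>F\<^esub> \<alpha> [^]\<^bsub>F\<^esub> s4"
      and \<beta>: "\<beta> [^]\<^bsub>F\<^esub> t1 \<otimes>\<^bsub>F\<^esub> \<beta> [^]\<^bsub>F\<^esub> t2 = \<beta> [^]\<^bsub>F\<^esub> t3 \<otimes>\<^bsub>F\<^esub> \<beta> [^]\<^bsub>F\<^esub> t4"
      using eq by (auto intro!: primitive_pow_mult_eq fin prim simp: 1 2 3 4 q)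
    \<comment> \<open>The way back from powers to coordinates; it relies on the strict bounds
      supplied by \<open>graphE\<close>.\<close>
    have inj: "i = j" if "\<theta> [^]\<^bsub>F\<^esub> i = \<theta> [^]\<^bsub>F\<^esub> j" "primitive_element F \<theta>" "i < q - 1" "j < q - 1"
      for \<theta> and i j :: nat
      using inj_onD [OF primitive_pow_inj_lessThan [OF fin that(2)] that(1)] that(3,4) q by simp
    have closed: "\<alpha> [^]\<^bsub>F\<^esub> i \<in> carrier F" "\<beta> [^]\<^bsub>F\<^esub> i \<in> carrier F" for i :: nat
      using prim primitive_element_closed by auto
    from eq_pairs_if_prods_eq [OF closed(1) closed(1) closed(1) closed(1)
        closed(2) closed(2) closed(2) closed(2) assms(8) 1(4) 2(4) 3(4) 4(4) \<alpha> \<beta>]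
    show ?thesis
      using 1 2 3 4 inj prim by (elim disjE conjE) simp_all
  qed
  have "log_graph F \<alpha> \<beta> a \<subseteq> carrier (?Z \<times>\<times> ?Z)"
    by (auto elim!: graphE simp: carrier_integer_mod_group)
  then show ?thesis
    unfolding sidon_set_def using sidon DirProd_comm_group [of ?Z ?Z] by simp metis
qed

end
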